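(* If $\mathcal A=[[a_0;\dots;a_r]]$ and $\mathcal B=[[b_0;\dots;b_s]]$ are ordered brackets, then $\mathcal C=[[a_0;\dots;a_{r-1};\,a_r+b_0-1;\,b_1;\dots;b_s]]$ is an ordered bracket as well.
   Context: Teams $t_1,\dots,t_n$ are given in seed order; smaller numbers are higher seeds. A matchup table is a matrix $p_{ij}=\mathbb P[t_i\text{ beats }t_j]\in[0,1]$ with $p_{ij}+p_{ji}=1$ (so $p_{ii}=1/2$); game outcomes are independent. The list of teams is strongly stochastically transitive (SST) if $p_{ij}\le p_{ik}$ for all $i,j,k$ with $j<k$. A bracket on $n\ge1$ teams is a full binary tree (children unordered) whose $n$ leaves are labelled bijectively by the seeds $1,\dots,n$. Team $t_i$ begins at the leaf labelled $i$. Each internal node is a game between the teams arriving from its two children; the winner moves up and the loser plays no more games; the team reaching the root is the champion. If the tree has height $r$, there are $r$ rounds: the games at distance $d$ from the root form round $r-d$. A team has a bye in round $s$ if it plays no game in round $s$ or before; a team whose leaf is at distance $d$ from the root has $r-d$ byes. The signature of an $r$-round bracket is $[[a_0;\dots;a_r]]$, where $a_i$ is the number of teams with exactly $i$ byes. A bracket goes chalk if the higher-seeded team (smaller number) wins every game. A bracket is proper if, when it goes chalk, for every round and all $i<j$ with $t_i,t_j$ not having lost before that round: if $t_j$ has a bye in that round then so does $t_i$, and if both play in that round then the opponent of $t_i$ has a larger seed number than the opponent of $t_j$. There is exactly one proper bracket with each bracket signature, and "the bracket $\mathcal A$" for a signature $\mathcal A$ means the proper bracket with that signature. An $n$-team tournament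 format is ordered if for every SST list of $n$ teams and all $i<j$, the probability that $t_i$ is champion is at least the probability that $t_j$ is champion. *)

theory Defs
  imports "HOL-Probability.Probability"
begin

text \<open>
  The children of a game are unordered. We represent them in some order; all notions below are
  invariant under exchanging the children of a game (for the champion this uses
  \<open>p i j + p j i = 1\<close>), so each bracket is represented by several trees that agree in every
  respect considered here.
\<close>

datatype bracket_tree = Team nat | Game bracket_tree bracket_tree

primrec leaves :: "bracket_tree \<Rightarrow> nat list" where
  "leaves (Team i) = [i]"
| "leaves (Game x y) = leaves x @ leaves y"

primrec num_rounds :: "bracket_tree \<Rightarrow> nat" where
  "num_rounds (Team i) = 0"
| "num_rounds (Game x y) = Suc (max (num_rounds x) (num_rounds y))"

definition is_bracket :: "nat \<Rightarrow> bracket_tree \<Rightarrow> bool" where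
  "is_bracket n T \<longleftrightarrow> distinct (leaves T) \<and> set (leaves T) = {1..n}"

text \<open>The subtrees rooted at distance \<open>d\<close> from the root.\<close>

fun nodes_at :: "bracket_tree \<Rightarrow> nat \<Rightarrow> bracket_tree set" where
  "nodes_at T 0 = {T}"
| "nodes_at (Team i) (Suc d) = {}"
| "nodes_at (Game x y) (Suc d) = nodes_at x d \<union> nodes_at y d"

text \<open>
  Rounds are numbered \<open>1, \<dots>, num_rounds T\<close>. A team whose leaf is at distance \<open>d\<close> from the root
  plays its first game in round \<open>num_rounds T - d + 1\<close>, and has a bye in exactly the rounds before.
\<close>

definition has_bye :: "bracket_tree \<Rightarrow> nat \<Rightarrow> nat \<Rightarrow> bool" where
  "has_bye T s i \<longleftrightarrow> (\<exists>d. Team i \<in> nodes_at T d \<and> s + d \<le> num_rounds T)"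

text \<open>
  \<open>signature T ! k\<close> is the number of teams with exactly \<open>k\<close> byes, that is, whose leaf is at
  distance \<open>num_rounds T - k\<close> from the root.
\<close>

definition signature :: "bracket_tree \<Rightarrow> nat list" where
  "signature T = map (\<lambda>k. card {i. Team i \<in> nodes_at T (num_rounds T - k)}) [0..<Suc (num_rounds T)]"

primrec chalk_winner :: "bracket_tree \<Rightarrow> nat" where
  "chalk_winner (Team i) = i"
| "chalk_winner (Game x y) = min (chalk_winner x) (chalk_winner y)"

text \<open>\<open>chalk_game T s i k\<close>: if \<open>T\<close> goes chalk, then \<open>i\<close> and \<open>k\<close> play each other in round \<open>s\<close>.\<close>

definition chalk_game :: "bracket_tree \<Rightarrow> nat \<Rightarrow> nat \<Rightarrow> nat \<Rightarrow> bool" where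
  "chalk_game T s i k \<longleftrightarrow> s \<in> {1..num_rounds T} \<and>
     (\<exists>x y. Game x y \<in> nodes_at T (num_rounds T - s) \<and>
        (i = chalk_winner x \<and> k = chalk_winner y \<or> i = chalk_winner y \<and> k = chalk_winner x))"

definition chalk_alive :: "bracket_tree \<Rightarrow> nat \<Rightarrow> nat \<Rightarrow> bool" where
  "chalk_alive T s i \<longleftrightarrow> i \<in> set (leaves T) \<and> \<not> (\<exists>s' k. s' < s \<and> chalk_game T s' i k \<and> k < i)"

definition proper :: "bracket_tree \<Rightarrow> bool" where
  "proper T \<longleftrightarrow> (\<forall>s \<in> {1..num_rounds T}. \<forall>i j.
     i < j \<and> chalk_alive T s i \<and> chalk_alive T s j \<longrightarrow>
       (has_bye T s j \<longrightarrow> has_bye T s i) \<and>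
       (\<forall>k l. chalk_game T s i k \<and> chalk_game T s j l \<longrightarrow> l < k))"

text \<open>In a matchup table \<open>p\<close>, only the entries with indices in \<open>{1..n}\<close> are meaningful.\<close>

type_synonym matchup_table = "nat \<Rightarrow> nat \<Rightarrow> real"

definition is_matchup_table :: "nat \<Rightarrow> matchup_table \<Rightarrow> bool" where
  "is_matchup_table n p \<longleftrightarrow>
     (\<forall>i \<in> {1..n}. \<forall>j \<in> {1..n}. 0 \<le> p i j \<and> p i j \<le> 1 \<and> p i j + p j i = 1)"

definition SST :: "nat \<Rightarrow> matchup_table \<Rightarrow> bool" where
  "SST n p \<longleftrightarrow> is_matchup_table n p \<and>
     (\<forall>i \<in> {1..n}. \<forall>j \<in> {1..n}. \<forall>k \<in> {1..n}. j < k \<longrightarrow> p i j \<le> p i k)"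

text \<open>A format assigns to each matchup table the distribution of the champion.\<close>

type_synonym format = "matchup_table \<Rightarrow> nat pmf"

definition ordered_format :: "nat \<Rightarrow> format \<Rightarrow> bool" where
  "ordered_format n F \<longleftrightarrow>
     (\<forall>p. SST n p \<longrightarrow> (\<forall>i \<in> {1..n}. \<forall>j \<in> {1..n}. i < j \<longrightarrow> pmf (F p) j \<le> pmf (F p) i))"

primrec champion :: "bracket_tree \<Rightarrow> format" where
  "champion (Team i) p = return_pmf i"
| "champion (Game x y) p =
     do {
       i \<leftarrow> champion x p;
       j \<leftarrow> champion y p;
       i_wins \<leftarrow> bernoulli_pmf (p i j);
       return_pmf (if i_wins then i else j)
     }"

definition proper_bracket_with :: "nat list \<Rightarrow> bracket_tree \<Rightarrow> bool" where
  "proper_bracket_with A T \<longleftrightarrow> is_bracket (sum_list A) T \<and> proper T \<and> signature T = A"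

text \<open>
  \<open>A\<close> is the signature of a proper bracket, and this bracket is ordered. The proper bracket with
  signature \<open>A\<close> is unique only up to the order of children, hence the quantification over all
  trees representing it.
\<close>

definition ordered_bracket :: "nat list \<Rightarrow> bool" where
  "ordered_bracket A \<longleftrightarrow>
     (\<exists>T. proper_bracket_with A T) \<and>
     (\<forall>T. proper_bracket_with A T \<longrightarrow> ordered_format (sum_list A) (champion T))"

end

theory Submission
  imports Defs
begin

text \<open>
  For \<open>r > 0\<close> no team of \<open>A\<close> has \<open>r\<close> byes, and the proper bracket for the joined signature is the
  bracket of \<open>B\<close> with the leaf of its lowest seed \<open>m\<close> replaced by the bracket of \<open>A\<close> on the seeds
  from \<open>m\<close> on. Conversely every proper bracket with the joined signature has this shape: counting
  nodes level by level leaves exactly one game at the depth where the first round of \<open>B\<close> starts,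
  and properness forces the teams below it to be the lowest seeds.

  For such a bracket, condition on the winner \<open>k\<close> of the copy of \<open>A\<close>, who then plays \<open>B\<close> in the role of
  seed \<open>m\<close>. Two teams above \<open>m\<close>, or one above \<open>m\<close> and one below, compare because \<open>B\<close> is ordered
  for each \<open>k\<close>; two teams in \<open>A\<close> compare because \<open>A\<close> is ordered and because the chance of the
  entrant \<open>m\<close> in \<open>B\<close> grows with its strength.
\<close>

section \<open>Nodes, leaves and signatures\<close>

definition leaves_at :: "bracket_tree \<Rightarrow> nat \<Rightarrow> nat set" where
  "leaves_at T d = {i. Team i \<in> nodes_at T d}"

lemma finite_nodes_at [simp]: "finite (nodes_at T d)"
  by (induction T d rule: nodes_at.induct) auto

lemma finite_leaves_at [simp]: "finite (leaves_at T d)"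
proof -
  have "Team ` leaves_at T d \<subseteq> nodes_at T d"
    by (auto simp: leaves_at_def)
  then show ?thesis
    by (metis finite_imageD finite_nodes_at finite_subset inj_onI bracket_tree.inject(1))
qed

lemma leaves_nonempty [simp]: "leaves T \<noteq> []"
  by (induction T) auto

lemma leaves_node_subset: "Y \<in> nodes_at T d \<Longrightarrow> set (leaves Y) \<subseteq> set (leaves T)"
  by (induction T d rule: nodes_at.induct) auto

lemma distinct_leaves_node: "Y \<in> nodes_at T d \<Longrightarrow> distinct (leaves T) \<Longrightarrow> distinct (leaves Y)"
  by (induction T d rule: nodes_at.induct) auto

lemma leaf_of_Team_node: "Team i \<in> nodes_at T d \<Longrightarrow> i \<in> set (leaves T)"
  using leaves_node_subset by fastforce

lemma Team_node_of_leaf: "i \<in> set (leaves T) \<Longrightarrow> \<exists>d. Team i \<in> nodes_at T d"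
proof (induction T)
  case (Team j)
  then show ?case by (auto intro: exI[of _ 0])
next
  case (Game x y)
  then obtain d where "Team i \<in> nodes_at x d \<union> nodes_at y d"
    by auto
  then show ?case
    by (intro exI[of _ "Suc d"]) simp
qed

lemma disjoint_nodes_at:
  assumes "distinct (leaves (Game x y))"
  shows "nodes_at x d \<inter> nodes_at y e = {}"
proof (rule ccontr)
  assume "nodes_at x d \<inter> nodes_at y e \<noteq> {}"
  then obtain z where "z \<in> nodes_at x d" "z \<in> nodes_at y e"
    by blast
  then have "set (leaves z) \<subseteq> set (leaves x) \<inter> set (leaves y)"
    using leaves_node_subset by blast
  then show False
    using assms leaves_nonempty[of z] by (metis distinct_append leaves.simps(2) set_empty subset_empty)
qed

text \<open>This makes the number of byes a function of the team and turns the existential in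
  \<open>has_bye\<close> into an inequality (\<open>has_bye_iff\<close>).\<close>

lemma Team_depth_unique:
  "distinct (leaves T) \<Longrightarrow> Team i \<in> nodes_at T d \<Longrightarrow> Team i \<in> nodes_at T e \<Longrightarrow> d = e"
proof (induction T arbitrary: d e)
  case (Team j)
  then show ?case by (cases d; cases e) auto
next
  case (Game x y)
  obtain d' e' where de: "d = Suc d'" "e = Suc e'"
    using Game.prems by (cases d; cases e) auto
  have dist: "distinct (leaves x)" "distinct (leaves y)"
    using Game.prems(1) by auto
  consider "Team i \<in> nodes_at x d'" "Team i \<in> nodes_at x e'"
    | "Team i \<in> nodes_at y d'" "Team i \<in> nodes_at y e'"
    using Game.prems(2,3) disjoint_nodes_at[OF Game.prems(1)] de by auto
  then show ?case
    by cases (use Game.IH dist de in blast)+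
qed

lemma depth_le_num_rounds: "Y \<in> nodes_at T d \<Longrightarrow> d + num_rounds Y \<le> num_rounds T"
  by (induction T d rule: nodes_at.induct) auto

lemma deepest_leaf: "\<exists>i. Team i \<in> nodes_at T (num_rounds T)"
proof (induction T)
  case (Game x y)
  then show ?case
    by (cases "num_rounds x \<le> num_rounds y") (auto simp: max_def)
qed simp

lemma num_rounds_eq_0_iff: "num_rounds T = 0 \<longleftrightarrow> (\<exists>i. T = Team i)"
  by (cases T) auto

lemma nodes_at_deepest: "Y \<in> nodes_at T (num_rounds T) \<Longrightarrow> \<exists>i. Y = Team i"
  using depth_le_num_rounds[of Y T "num_rounds T"] num_rounds_eq_0_iff by simp

lemma nodes_at_add: "nodes_at T (d + e) = (\<Union>Y\<in>nodes_at T d. nodes_at Y e)"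
proof (induction T d rule: nodes_at.induct)
  case (2 i d)
  then show ?case by simp
qed auto

text \<open>Every node that is not a leaf has two children. As \<open>nodes_at\<close> is a set of
  subtrees, distinct labels keep equal subtrees from being counted once. Read as a recurrence, this
  lets the leaf counts fix the node counts.\<close>

lemma card_nodes_at_Suc:
  "distinct (leaves T) \<Longrightarrow>
    card (nodes_at T (Suc d)) + 2 * card (leaves_at T d) = 2 * card (nodes_at T d)"
proof (induction T arbitrary: d)
  case (Team i)
  then show ?case by (cases d) (auto simp: leaves_at_def)
next
  case (Game x y)
  have dist: "distinct (leaves x)" "distinct (leaves y)"
    using Game.prems by auto
  note disj = disjoint_nodes_at[OF Game.prems]
  have nodes: "card (nodes_at (Game x y) (Suc e)) = card (nodes_at x e) + card (nodes_at y e)" for e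
    using disj by (simp add: card_Un_disjoint)
  show ?case
  proof (cases d)
    case 0
    then show ?thesis
      using nodes[of 0] by (simp add: leaves_at_def)
  next
    case (Suc e)
    have "leaves_at (Game x y) (Suc e) = leaves_at x e \<union> leaves_at y e"
      by (auto simp: leaves_at_def)
    moreover have "leaves_at x e \<inter> leaves_at y e = {}"
      using disj by (auto simp: leaves_at_def)
    ultimately have "card (leaves_at (Game x y) (Suc e)) = card (leaves_at x e) + card (leaves_at y e)"
      by (simp add: card_Un_disjoint)
    then show ?thesis
      using nodes[of e] nodes[of "Suc e"] Game.IH(1)[OF dist(1), of e] Game.IH(2)[OF dist(2), of e]
      unfolding Suc by linarith
  qed
qed

section \<open>Signatures as leaf counts by depth\<close>

lemma length_signature [simp]: "length (signature T) = Suc (num_rounds T)"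
  by (simp add: signature_def)

lemma nth_signature:
  "k \<le> num_rounds T \<Longrightarrow> signature T ! k = card (leaves_at T (num_rounds T - k))"
  by (simp add: signature_def leaves_at_def del: upt_Suc)

lemma sum_list_signature:
  assumes "distinct (leaves T)"
  shows "sum_list (signature T) = card (set (leaves T))"
proof -
  let ?R = "num_rounds T"
  have leaves: "set (leaves T) = (\<Union>d\<in>{..?R}. leaves_at T d)"
    using Team_node_of_leaf depth_le_num_rounds leaf_of_Team_node
    by (fastforce simp: leaves_at_def)
  have "sum_list (signature T) = (\<Sum>k\<in>{0..<Suc ?R}. card (leaves_at T (?R - k)))"
    by (simp add: signature_def leaves_at_def interv_sum_list_conv_sum_set_nat del: upt_Suc)
  also have "\<dots> = (\<Sum>d\<in>{..?R}. card (leaves_at T d))"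
    by (rule sum.reindex_bij_witness[of _ "\<lambda>d. ?R - d" "\<lambda>d. ?R - d"]) auto
  also have "\<dots> = card (set (leaves T))"
    unfolding leaves using Team_depth_unique[OF assms]
    by (intro card_UN_disjoint[symmetric] ballI finite_leaves_at finite_atMost) (auto simp: leaves_at_def)
  finally show ?thesis .
qed

section \<open>Chalk\<close>

lemma chalk_winner_eq_Min: "chalk_winner T = Min (set (leaves T))"
  by (induction T) (auto simp: Min_Un)

lemma chalk_winner_in_leaves: "chalk_winner T \<in> set (leaves T)"
  by (simp add: chalk_winner_eq_Min)

text \<open>A game has positive height, so it lies strictly above depth \<open>num_rounds T\<close>,
  and the truncated subtraction turning depth into round is invertible.\<close>

lemma Game_round:
  assumes "Game x y \<in> nodes_at T d"
  shows "num_rounds T - d \<in> {1..num_rounds T}" "num_rounds T - (num_rounds T - d) = d"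
  using depth_le_num_rounds[OF assms] by auto

text \<open>Induct down the tree: a team that wins its half but not the game loses at that game;
  otherwise the loss lies inside the half.\<close>

lemma chalk_loss:
  "i \<in> set (leaves T) \<Longrightarrow> i \<noteq> chalk_winner T \<Longrightarrow> \<exists>s k. chalk_game T s i k \<and> k < i"
proof -
  assume i: "i \<in> set (leaves T)" "i \<noteq> chalk_winner T"
  then have "\<exists>d x y. Game x y \<in> nodes_at T d \<and>
    (i = chalk_winner x \<and> chalk_winner y < i \<or> i = chalk_winner y \<and> chalk_winner x < i)"
  proof (induction T)
    case (Game x y)
    show ?case
    proof (cases "i = chalk_winner x \<or> i = chalk_winner y")
      case True
      then show ?thesis
        using Game.prems by (intro exI[of _ 0]) auto
    next
      case False
      then obtain d u v where "Game u v \<in> nodes_at x d \<union> nodes_at y d"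
        "i = chalk_winner u \<and> chalk_winner v < i \<or> i = chalk_winner v \<and> chalk_winner u < i"
        using Game by auto
      then show ?thesis
        by (intro exI[of _ "Suc d"]) auto
    qed
  qed simp
  then obtain d x y where g: "Game x y \<in> nodes_at T d"
    "i = chalk_winner x \<and> chalk_winner y < i \<or> i = chalk_winner y \<and> chalk_winner x < i"
    by blast
  then have "chalk_game T (num_rounds T - d) i (if i = chalk_winner x then chalk_winner y else chalk_winner x)"
    unfolding chalk_game_def using Game_round[OF g(1)] by force
  with g(2) show ?thesis
    by (auto split: if_splits)
qed

lemma chalk_game_leaf: "chalk_game T s i k \<Longrightarrow> i \<in> set (leaves T)"
  using leaves_node_subset chalk_winner_in_leaves
  by (fastforce simp: chalk_game_def)

text \<open>A loss in an earlier round would happen at a game too deep in the tree to have the leaf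
  of \<open>i\<close> below it.\<close>

lemma chalk_alive_first_game:
  assumes dist: "distinct (leaves T)" and i: "Team i \<in> nodes_at T d" and t: "t + d \<le> Suc (num_rounds T)"
  shows "chalk_alive T t i"
  unfolding chalk_alive_def
proof (intro conjI notI)
  show "i \<in> set (leaves T)"
    using i by (rule leaf_of_Team_node)
  assume "\<exists>t' k. t' < t \<and> chalk_game T t' i k \<and> k < i"
  then obtain t' x y where t': "t' < t" "1 \<le> t'" "t' \<le> num_rounds T"
    and g: "Game x y \<in> nodes_at T (num_rounds T - t')" "i \<in> {chalk_winner x, chalk_winner y}"
    unfolding chalk_game_def by auto
  obtain e where "Team i \<in> nodes_at x e \<union> nodes_at y e"
    using g(2) chalk_winner_in_leaves Team_node_of_leaf by blast
  then have "Team i \<in> nodes_at (Game x y) (Suc e)"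
    by simp
  then have "Team i \<in> nodes_at T (num_rounds T - t' + Suc e)"
    using g(1) unfolding nodes_at_add by blast
  then have "d = num_rounds T - t' + Suc e"
    using Team_depth_unique[OF dist i] by blast
  then show False
    using t t' by linarith
qed

lemma has_bye_iff:
  assumes "distinct (leaves T)" "Team i \<in> nodes_at T d"
  shows "has_bye T s i \<longleftrightarrow> s + d \<le> num_rounds T"
  unfolding has_bye_def using Team_depth_unique[OF assms] assms(2) by blast

text \<open>Some team \<open>i\<close> starts at maximal depth and plays in round 1, when nobody has
  lost yet. A round-1 bye for \<open>m\<close> would by properness give one to the higher seed
  \<open>i\<close>.\<close>

lemma proper_lowest_seed_plays_first:
  assumes "is_bracket m S" "proper S"
  shows "Team m \<in> nodes_at S (num_rounds S)"
proof -
  have dist: "distinct (leaves S)" and set: "set (leaves S) = {1..m}"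
    using assms(1) by (auto simp: is_bracket_def)
  have "m \<in> set (leaves S)"
    using chalk_winner_in_leaves[of S] set by auto
  then obtain d where d: "Team m \<in> nodes_at S d"
    using Team_node_of_leaf by blast
  obtain i where i: "Team i \<in> nodes_at S (num_rounds S)"
    using deepest_leaf by blast
  then have "i \<le> m"
    using leaf_of_Team_node[OF i] set by simp
  have d_le: "d \<le> num_rounds S"
    using depth_le_num_rounds[OF d] by simp
  have "d = num_rounds S"
  proof (rule ccontr)
    assume "d \<noteq> num_rounds S"
    then have lt: "d < num_rounds S"
      using d_le by simp
    then have "i < m"
      using Team_depth_unique[OF dist d] i \<open>i \<le> m\<close> by (cases "i = m") auto
    moreover have "chalk_alive S 1 i" "chalk_alive S 1 m"
      using chalk_alive_first_game[OF dist] i d d_le by fastforce+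
    ultimately have "has_bye S 1 m \<longrightarrow> has_bye S 1 i"
      using assms(2) lt unfolding proper_def by (auto dest!: bspec[of _ _ 1])
    then show False
      using has_bye_iff[OF dist d, of 1] has_bye_iff[OF dist i, of 1] lt by simp
  qed
  then show ?thesis
    using d by simp
qed

section \<open>Relabelling\<close>

primrec relabel :: "(nat \<Rightarrow> nat) \<Rightarrow> bracket_tree \<Rightarrow> bracket_tree" where
  "relabel f (Team i) = Team (f i)"
| "relabel f (Game x y) = Game (relabel f x) (relabel f y)"

lemma leaves_relabel [simp]: "leaves (relabel f T) = map f (leaves T)"
  by (induction T) auto

lemma num_rounds_relabel [simp]: "num_rounds (relabel f T) = num_rounds T"
  by (induction T) auto

lemma nodes_at_relabel [simp]: "nodes_at (relabel f T) d = relabel f ` nodes_at T d"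
  by (induction T d rule: nodes_at.induct) auto

lemma relabel_relabel_id:
  "(\<And>i. i \<in> set (leaves T) \<Longrightarrow> f (g i) = i) \<Longrightarrow> relabel f (relabel g T) = T"
  by (induction T) auto

lemma relabel_id: "(\<And>i. i \<in> set (leaves T) \<Longrightarrow> f i = i) \<Longrightarrow> relabel f T = T"
  by (induction T) auto

lemma chalk_winner_relabel: "strict_mono f \<Longrightarrow> chalk_winner (relabel f T) = f (chalk_winner T)"
  by (induction T) (auto simp: min_def strict_mono_less_eq)

lemma Team_relabel_node_iff: "Team i \<in> relabel f ` A \<longleftrightarrow> (\<exists>j. i = f j \<and> Team j \<in> A)"
proof
  assume "Team i \<in> relabel f ` A"
  then obtain y where "y \<in> A" "relabel f y = Team i"
    by force
  then show "\<exists>j. i = f j \<and> Team j \<in> A"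
    by (cases y) auto
qed force

lemma Game_relabel_node_iff:
  "Game x y \<in> relabel f ` A \<longleftrightarrow> (\<exists>u v. x = relabel f u \<and> y = relabel f v \<and> Game u v \<in> A)"
proof
  assume "Game x y \<in> relabel f ` A"
  then obtain z where "z \<in> A" "relabel f z = Game x y"
    by force
  then show "\<exists>u v. x = relabel f u \<and> y = relabel f v \<and> Game u v \<in> A"
    by (cases z) auto
qed force

lemma signature_relabel:
  assumes "inj f"
  shows "signature (relabel f T) = signature T"
proof -
  have "{i. Team i \<in> nodes_at (relabel f T) d} = f ` {i. Team i \<in> nodes_at T d}" for d
    by (auto simp: Team_relabel_node_iff)
  then show ?thesis
    using assms by (simp add: signature_def card_image inj_on_subset[OF assms])
qed

text \<open>Properness only compares seeds by order, which an increasing relabelling preserves;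
  labels outside the range of \<open>f\<close> never occur in the relabelled tree.\<close>

lemma proper_relabel:
  assumes f: "strict_mono f"
  shows "proper (relabel f T) \<longleftrightarrow> proper T"
proof -
  have inj: "f i = f j \<longleftrightarrow> i = j" and less: "f i < f j \<longleftrightarrow> i < j" for i j
    using f by (auto simp: strict_mono_eq strict_mono_less)
  have bye: "has_bye (relabel f T) s (f i) \<longleftrightarrow> has_bye T s i" for s i
    by (auto simp: has_bye_def Team_relabel_node_iff inj)
  have game: "chalk_game (relabel f T) s i' k' \<longleftrightarrow> (\<exists>i k. i' = f i \<and> k' = f k \<and> chalk_game T s i k)" for s i' k'
    unfolding chalk_game_def num_rounds_relabel nodes_at_relabel Game_relabel_node_iff
    using chalk_winner_relabel[OF f] by (auto 0 4)
  have game': "chalk_game (relabel f T) s (f i) (f k) \<longleftrightarrow> chalk_game T s i k" for s i k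
    unfolding game by (auto simp: inj)
  have alive: "chalk_alive (relabel f T) s (f i) \<longleftrightarrow> chalk_alive T s i" for s i
  proof -
    have "(\<exists>s' k'. s' < s \<and> chalk_game (relabel f T) s' (f i) k' \<and> k' < f i) \<longleftrightarrow>
      (\<exists>s' k. s' < s \<and> chalk_game T s' i k \<and> k < i)"
      unfolding game by (metis inj less)
    then show ?thesis
      unfolding chalk_alive_def by (simp add: inj image_iff)
  qed
  have alive_range: "\<exists>i. i' = f i" if "chalk_alive (relabel f T) s i'" for s i'
    using that by (auto simp: chalk_alive_def)
  show ?thesis
    unfolding proper_def num_rounds_relabel
  proof (intro ball_cong refl iffI allI impI; elim conjE)
    fix s i j
    assume *: "\<forall>i j. i < j \<and> chalk_alive (relabel f T) s i \<and> chalk_alive (relabel f T) s j \<longrightarrow>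
       (has_bye (relabel f T) s j \<longrightarrow> has_bye (relabel f T) s i) \<and>
       (\<forall>k l. chalk_game (relabel f T) s i k \<and> chalk_game (relabel f T) s j l \<longrightarrow> l < k)"
      and ij: "i < j" "chalk_alive T s i" "chalk_alive T s j"
    have "(has_bye (relabel f T) s (f j) \<longrightarrow> has_bye (relabel f T) s (f i)) \<and>
       (\<forall>k l. chalk_game (relabel f T) s (f i) k \<and> chalk_game (relabel f T) s (f j) l \<longrightarrow> l < k)"
      using ij by (intro mp[OF spec[OF spec[OF *]]]) (simp add: alive less)
    then show "(has_bye T s j \<longrightarrow> has_bye T s i) \<and> (\<forall>k l. chalk_game T s i k \<and> chalk_game T s j l \<longrightarrow> l < k)"
      unfolding bye by (meson game' less)
  next
    fix s i' j'
    assume *: "\<forall>i j. i < j \<and> chalk_alive T s i \<and> chalk_alive T s j \<longrightarrow>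
       (has_bye T s j \<longrightarrow> has_bye T s i) \<and>
       (\<forall>k l. chalk_game T s i k \<and> chalk_game T s j l \<longrightarrow> l < k)"
      and ij': "i' < j'" "chalk_alive (relabel f T) s i'" "chalk_alive (relabel f T) s j'"
    obtain i j where ij: "i' = f i" "j' = f j"
      using alive_range ij' by blast
    have **: "(has_bye T s j \<longrightarrow> has_bye T s i) \<and> (\<forall>k l. chalk_game T s i k \<and> chalk_game T s j l \<longrightarrow> l < k)"
      using ij' unfolding ij by (intro mp[OF spec[OF spec[OF *]]]) (simp add: alive less)
    show "(has_bye (relabel f T) s j' \<longrightarrow> has_bye (relabel f T) s i') \<and>
      (\<forall>k l. chalk_game (relabel f T) s i' k \<and> chalk_game (relabel f T) s j' l \<longrightarrow> l < k)"
    proof (intro conjI allI impI)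
      show "has_bye (relabel f T) s i'" if "has_bye (relabel f T) s j'"
        using that ** unfolding ij bye by blast
      fix k' l'
      assume g: "chalk_game (relabel f T) s i' k' \<and> chalk_game (relabel f T) s j' l'"
      then obtain k l where kl: "k' = f k" "l' = f l"
        unfolding game by blast
      show "l' < k'"
        using g ** unfolding ij kl game' less by blast
    qed
  qed
qed

section \<open>Grafting a bracket onto a leaf\<close>

primrec graft :: "nat \<Rightarrow> bracket_tree \<Rightarrow> bracket_tree \<Rightarrow> bracket_tree" where
  "graft m X (Team i) = (if i = m then X else Team i)"
| "graft m X (Game x y) = Game (graft m X x) (graft m X y)"

lemma graft_idle [simp]: "m \<notin> set (leaves S) \<Longrightarrow> graft m X S = S"
  by (induction S) auto

lemma set_leaves_graft:
  "set (leaves (graft m X S)) =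
    (set (leaves S) - {m}) \<union> (if m \<in> set (leaves S) then set (leaves X) else {})"
  by (induction S) auto

lemma distinct_leaves_graft:
  assumes "distinct (leaves X)"
  shows "distinct (leaves S) \<Longrightarrow> set (leaves S) \<inter> set (leaves X) \<subseteq> {m} \<Longrightarrow>
    distinct (leaves (graft m X S))"
proof (induction S)
  case (Team i)
  then show ?case using assms by simp
next
  case (Game x y)
  have "set (leaves (graft m X x)) \<inter> set (leaves (graft m X y)) = {}"
    using Game.prems by (auto simp: set_leaves_graft)
  then show ?case
    using Game by auto
qed

text \<open>Equality can fail when the leaf \<open>m\<close> is shallow; for a deepest leaf
  \<open>num_rounds_T\<close> adds the reverse bound.\<close>

lemma num_rounds_graft_le: "num_rounds (graft m X S) \<le> num_rounds S + num_rounds X"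
  by (induction S) auto

lemma chalk_winner_graft: "chalk_winner X = m \<Longrightarrow> chalk_winner (graft m X S) = chalk_winner S"
  by (induction S) auto

text \<open>Down to the root of the grafted copy the two trees correspond node by node; a leaf
  \<open>m\<close> at a smaller depth would expose inner nodes of \<open>X\<close> instead.\<close>

lemma nodes_at_graft:
  "(\<And>e. e < d \<Longrightarrow> Team m \<notin> nodes_at S e) \<Longrightarrow> nodes_at (graft m X S) d = graft m X ` nodes_at S d"
proof (induction S arbitrary: d)
  case (Team i)
  show ?case
    using Team[of 0] by (cases d) auto
next
  case (Game x y)
  show ?case
  proof (cases d)
    case (Suc e)
    have "Team m \<notin> nodes_at x e'" "Team m \<notin> nodes_at y e'" if "e' < e" for e'
      using Game.prems[of "Suc e'"] that Suc by auto
    then show ?thesis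
      using Game.IH(1)[of e] Game.IH(2)[of e] Suc by (simp add: image_Un)
  qed simp
qed

text \<open>The demand of \<open>proper\<close> on one pair in one round, split off so that it can
  be transferred between brackets pair by pair.\<close>

definition proper_pair :: "bracket_tree \<Rightarrow> nat \<Rightarrow> nat \<Rightarrow> nat \<Rightarrow> bool" where
  "proper_pair T t i j \<longleftrightarrow> (has_bye T t j \<longrightarrow> has_bye T t i) \<and>
     (\<forall>k l. chalk_game T t i k \<and> chalk_game T t j l \<longrightarrow> l < k)"

lemma proper_iff:
  "proper T \<longleftrightarrow> (\<forall>t\<in>{1..num_rounds T}. \<forall>i j.
    i < j \<and> chalk_alive T t i \<and> chalk_alive T t j \<longrightarrow> proper_pair T t i j)"
  unfolding proper_def proper_pair_def ..

text \<open>\<open>S\<close> plays the part of the bracket of \<open>B\<close>, and \<open>X\<close>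
  that of the bracket of \<open>A\<close> moved to the seeds from \<open>m\<close> on, so that its
  top seed takes the place of the lowest seed of \<open>S\<close>. As \<open>X\<close> has a round,
  it is the only game at depth \<open>num_rounds S\<close> of the grafted tree.\<close>

locale grafting =
  fixes m N :: nat and X S :: bracket_tree
  assumes S: "is_bracket m S"
    and deepest: "Team m \<in> nodes_at S (num_rounds S)"
    and distinct_X: "distinct (leaves X)"
    and leaves_X: "set (leaves X) = {m..N}"
    and rounds_X: "0 < num_rounds X"
begin

abbreviation "T \<equiv> graft m X S"
abbreviation "r \<equiv> num_rounds X"
abbreviation "s \<equiv> num_rounds S"

section \<open>Nodes and leaves of the grafted bracket\<close>

lemma distinct_S: "distinct (leaves S)" and leaves_S: "set (leaves S) = {1..m}"
  using S by (auto simp: is_bracket_def)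

lemma m_pos: "1 \<le> m" and m_le_N: "m \<le> N"
  using chalk_winner_in_leaves[of S] leaves_S chalk_winner_in_leaves[of X] leaves_X by auto

lemma chalk_winner_X: "chalk_winner X = m"
  unfolding chalk_winner_eq_Min leaves_X using m_le_N by (intro Min_eqI) auto

lemma leaves_T: "set (leaves T) = {1..N}"
  using m_pos m_le_N by (auto simp: set_leaves_graft leaves_S leaves_X)

lemma distinct_T: "distinct (leaves T)"
  using m_pos m_le_N distinct_leaves_graft[OF distinct_X distinct_S, of m] by (auto simp: leaves_S leaves_X)

lemma is_bracket_T: "is_bracket N T"
  by (simp add: is_bracket_def distinct_T leaves_T)

lemma X_not_Team: "X \<noteq> Team i"
  using rounds_X by auto

lemma Team_m_depth: "Team m \<in> nodes_at S d \<longleftrightarrow> d = s"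
  using deepest Team_depth_unique[OF distinct_S deepest] by blast

lemma nodes_at_T: "d \<le> s \<Longrightarrow> nodes_at T d = graft m X ` nodes_at S d"
  by (rule nodes_at_graft) (simp add: Team_m_depth)

lemma X_node: "X \<in> nodes_at T s"
  using deepest nodes_at_T[of s] by force

lemma num_rounds_T: "num_rounds T = s + r"
  using num_rounds_graft_le[of m X S] depth_le_num_rounds[OF X_node] by simp

lemma nodes_at_T_s: "Y \<in> nodes_at T s \<Longrightarrow> Y = X \<or> (\<exists>i. Y = Team i)"
  unfolding nodes_at_T[OF order_refl] using nodes_at_deepest[of _ S] by force

lemma nodes_at_T_below: "nodes_at T (s + Suc d) = nodes_at X (Suc d)"
  unfolding nodes_at_add[of T] using nodes_at_T_s X_node by force

lemma Game_node_below: "Game x y \<in> nodes_at T (s + d) \<longleftrightarrow> Game x y \<in> nodes_at X d"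
proof (cases d)
  case 0
  then show ?thesis
    using nodes_at_T_s X_node by auto
next
  case (Suc e)
  then show ?thesis
    using nodes_at_T_below by simp
qed

lemma Team_node:
  "Team i \<in> nodes_at T d \<longleftrightarrow> i \<noteq> m \<and> Team i \<in> nodes_at S d \<or> s \<le> d \<and> Team i \<in> nodes_at X (d - s)"
proof (cases "d \<le> s")
  case True
  have "Team i = graft m X y \<longleftrightarrow> i \<noteq> m \<and> y = Team i" for y
    using X_not_Team[of i] by (cases y) (simp_all, metis)
  then have "Team i \<in> nodes_at T d \<longleftrightarrow> i \<noteq> m \<and> Team i \<in> nodes_at S d"
    by (auto simp add: nodes_at_T[OF True] image_iff)
  \<comment> \<open>Here \<open>d - s\<close> is 0, and the only node of \<open>X\<close> at depth 0
    is the game \<open>X\<close> itself.\<close>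
  moreover have "Team i \<notin> nodes_at X (d - s)"
    using True X_not_Team[of i] by simp
  ultimately show ?thesis by blast
next
  case False
  then obtain e where d: "d = s + Suc e"
    by (metis add_Suc_right less_imp_Suc_add not_le)
  have "Team i \<notin> nodes_at S d"
    using depth_le_num_rounds[of "Team i" S d] False by auto
  then show ?thesis
    unfolding d nodes_at_T_below by simp
qed

lemma Team_node_low: "i < m \<Longrightarrow> Team i \<in> nodes_at T d \<longleftrightarrow> Team i \<in> nodes_at S d"
  using Team_node leaf_of_Team_node[of i X "d - s"] leaves_X by auto

lemma Team_node_high: "m \<le> i \<Longrightarrow> Team i \<in> nodes_at T d \<longleftrightarrow> s \<le> d \<and> Team i \<in> nodes_at X (d - s)"
  using Team_node leaf_of_Team_node[of i S d] leaves_S by auto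

lemma leaves_at_T_below:
  assumes "s < d"
  shows "leaves_at T d = leaves_at X (d - s)"
  using assms depth_le_num_rounds[of _ S d] by (fastforce simp: leaves_at_def Team_node)

lemma leaves_at_T_s: "leaves_at T s = leaves_at S s - {m}"
  using X_not_Team by (auto simp: leaves_at_def Team_node)

lemma leaves_at_T_above:
  assumes "d < s"
  shows "leaves_at T d = leaves_at S d"
  using assms Team_m_depth[of d] by (auto simp: leaves_at_def Team_node)

text \<open>A leaf with \<open>k\<close> byes has depth \<open>s + r - k\<close>. Below depth
  \<open>s\<close> it lies in \<open>X\<close>; at depth \<open>s\<close> it is a deepest leaf of
  \<open>S\<close> other than \<open>m\<close>; above, it keeps its place in \<open>S\<close>, where
  it has \<open>r\<close> byes fewer.\<close>

lemma nth_signature_T: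
  assumes "k \<le> s + r"
  shows "signature T ! k =
    (if k < r then signature X ! k
     else if k = r then signature S ! 0 - 1 else signature S ! (k - r))"
proof -
  have T: "signature T ! k = card (leaves_at T (s + r - k))"
    using assms by (simp add: nth_signature num_rounds_T)
  consider "k < r" | "k = r" | "r < k"
    by linarith
  then show ?thesis
  proof cases
    case 1
    then show ?thesis
      using T leaves_at_T_below[of "s + r - k"] by (simp add: nth_signature)
  next
    case 2
    have "m \<in> leaves_at S s"
      using deepest by (simp add: leaves_at_def)
    then show ?thesis
      using T 2 by (simp add: nth_signature leaves_at_T_s)
  next
    case 3
    then show ?thesis
      using T assms leaves_at_T_above[of "s + r - k"] by (simp add: nth_signature)
  qed
qed

section \<open>Rounds and properness of the grafted bracket\<close>

lemma chalk_game_T_X: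
  assumes "t \<le> r"
  shows "chalk_game T t i k \<longleftrightarrow> chalk_game X t i k"
proof -
  have "Game x y \<in> nodes_at T (num_rounds T - t) \<longleftrightarrow> Game x y \<in> nodes_at X (r - t)" for x y
    using assms Game_node_below[of x y "r - t"] by (simp add: num_rounds_T)
  then show ?thesis
    unfolding chalk_game_def using assms by (simp add: num_rounds_T)
qed

text \<open>Rounds after \<open>r\<close> are played at depths less than \<open>s\<close>, by the
  games of \<open>S\<close>. Their chalk participants are unchanged because the chalk winner of
  \<open>X\<close> is \<open>m\<close>, the label of the replaced leaf.\<close>

lemma chalk_game_T_S:
  assumes "1 \<le> t"
  shows "chalk_game T (r + t) i k \<longleftrightarrow> chalk_game S t i k"
proof (cases "t \<le> s")
  case True
  let ?d = "s - t"
  have d: "num_rounds T - (r + t) = ?d" "?d \<le> s" "?d \<noteq> s"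
    using True assms by (auto simp: num_rounds_T)
  \<comment> \<open>A general \<open>P\<close> lets one instance cover both orders of the
    participants.\<close>
  have "(\<exists>x y. Game x y \<in> nodes_at T ?d \<and> P (chalk_winner x) (chalk_winner y)) \<longleftrightarrow>
    (\<exists>x y. Game x y \<in> nodes_at S ?d \<and> P (chalk_winner x) (chalk_winner y))" for P
  proof
    assume "\<exists>x y. Game x y \<in> nodes_at T ?d \<and> P (chalk_winner x) (chalk_winner y)"
    then obtain x y z where z: "z \<in> nodes_at S ?d" "Game x y = graft m X z"
      and P: "P (chalk_winner x) (chalk_winner y)"
      unfolding nodes_at_T[OF d(2)] by auto
    have "z \<noteq> Team m"
      using z(1) Team_m_depth d(3) by blast
    then obtain u v where "z = Game u v" "x = graft m X u" "y = graft m X v"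
      using z(2) by (cases z) (auto split: if_splits)
    then show "\<exists>x y. Game x y \<in> nodes_at S ?d \<and> P (chalk_winner x) (chalk_winner y)"
      using z(1) P chalk_winner_graft[OF chalk_winner_X] by auto
  next
    assume "\<exists>x y. Game x y \<in> nodes_at S ?d \<and> P (chalk_winner x) (chalk_winner y)"
    then obtain x y where xy: "Game x y \<in> nodes_at S ?d" and P: "P (chalk_winner x) (chalk_winner y)"
      by blast
    have "Game (graft m X x) (graft m X y) \<in> nodes_at T ?d"
      using imageI[OF xy, of "graft m X"] nodes_at_T[OF d(2)] by simp
    then show "\<exists>x y. Game x y \<in> nodes_at T ?d \<and> P (chalk_winner x) (chalk_winner y)"
      using P chalk_winner_graft[OF chalk_winner_X] by metis
  qed
  note this[of "\<lambda>a b. i = a \<and> k = b \<or> i = b \<and> k = a"]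
  then show ?thesis
    unfolding chalk_game_def d(1) using True assms by (simp add: num_rounds_T)
next
  case False
  then show ?thesis
    by (simp add: chalk_game_def num_rounds_T)
qed

lemma chalk_alive_T_X:
  assumes "t \<le> Suc r" "m \<le> i" "i \<le> N"
  shows "chalk_alive T t i \<longleftrightarrow> chalk_alive X t i"
  using assms m_pos by (auto simp: chalk_alive_def leaves_T leaves_X chalk_game_T_X)

text \<open>After \<open>r\<close> chalk rounds exactly the seeds up to \<open>m\<close> survive,
  and these are the entrants of \<open>S\<close>; from then on the losses in \<open>T\<close> and
  \<open>S\<close> coincide.\<close>

lemma chalk_alive_T_S:
  assumes "1 \<le> t"
  shows "chalk_alive T (r + t) i \<longleftrightarrow> chalk_alive S t i"
proof -
  have split: "(\<exists>t' k. t' < r + t \<and> chalk_game T t' i k \<and> k < i) \<longleftrightarrow>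
    (\<exists>t' k. chalk_game X t' i k \<and> k < i) \<or> (\<exists>t' k. t' < t \<and> chalk_game S t' i k \<and> k < i)"
    (is "?L \<longleftrightarrow> ?X \<or> ?S")
  proof
    assume ?L
    then obtain t' k where t': "t' < r + t" "chalk_game T t' i k" "k < i"
      by blast
    show "?X \<or> ?S"
    proof (cases "t' \<le> r")
      case True
      then show ?thesis
        using t' chalk_game_T_X by blast
    next
      case False
      then have "r + (t' - r) = t'" "1 \<le> t' - r" "t' - r < t"
        using t'(1) by auto
      then show ?thesis
        using t' chalk_game_T_S by metis
    qed
  next
    assume "?X \<or> ?S"
    then show ?L
    proof
      assume ?X
      then obtain t' k where t': "chalk_game X t' i k" "k < i"
        by blast
      moreover have "t' \<le> r"
        using t' by (simp add: chalk_game_def)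
      ultimately show ?L
        using chalk_game_T_X assms by (intro exI[of _ t'] exI[of _ k]) auto
    next
      assume ?S
      then obtain t' k where t': "t' < t" "chalk_game S t' i k" "k < i"
        by blast
      moreover have "1 \<le> t'"
        using t' by (simp add: chalk_game_def)
      ultimately show ?L
        using chalk_game_T_S by (intro exI[of _ "r + t'"] exI[of _ k]) auto
    qed
  qed
  \<comment> \<open>The top seed \<open>m\<close> wins \<open>X\<close>, every other team of
    \<open>X\<close> loses in it, and seeds smaller than \<open>m\<close> play no game
    there.\<close>
  have X_loss: "(\<exists>t' k. chalk_game X t' i k \<and> k < i) \<longleftrightarrow> m < i" if "i \<in> {1..N}"
  proof
    assume "\<exists>t' k. chalk_game X t' i k \<and> k < i"
    then obtain t' k where g: "chalk_game X t' i k" "k < i"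
      by blast
    then have "chalk_game X t' k i"
      by (auto simp: chalk_game_def)
    then have "m \<le> k"
      using chalk_game_leaf leaves_X by fastforce
    then show "m < i"
      using g by simp
  next
    assume "m < i"
    then show "\<exists>t' k. chalk_game X t' i k \<and> k < i"
      using chalk_loss[of i X] that by (simp add: leaves_X chalk_winner_X)
  qed
  have "chalk_alive T (r + t) i \<longleftrightarrow> i \<in> {1..N} \<and> \<not> m < i \<and> \<not> (\<exists>t' k. t' < t \<and> chalk_game S t' i k \<and> k < i)"
    unfolding chalk_alive_def leaves_T split using X_loss by blast
  also have "\<dots> \<longleftrightarrow> chalk_alive S t i"
    unfolding chalk_alive_def leaves_S using m_le_N by auto
  finally show ?thesis .
qed

lemma has_bye_T_X:
  assumes "m \<le> i" "i \<le> N"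
  shows "has_bye T t i \<longleftrightarrow> has_bye X t i"
proof -
  obtain d where d: "Team i \<in> nodes_at X d"
    using assms Team_node_of_leaf[of i X] leaves_X by auto
  then have "Team i \<in> nodes_at T (s + d)"
    using Team_node_high[OF assms(1)] by simp
  then show ?thesis
    using has_bye_iff[OF distinct_T] has_bye_iff[OF distinct_X d] by (auto simp: num_rounds_T)
qed

lemma has_bye_T_low:
  assumes "1 \<le> i" "i < m"
  shows "t \<le> r \<Longrightarrow> has_bye T t i" and "has_bye T (r + t) i \<longleftrightarrow> has_bye S t i"
proof -
  obtain d where d: "Team i \<in> nodes_at S d"
    using assms Team_node_of_leaf[of i S] leaves_S by auto
  then have T: "Team i \<in> nodes_at T d" and "d \<le> s"
    using Team_node_low[OF assms(2)] depth_le_num_rounds[OF d] by auto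
  then show "t \<le> r \<Longrightarrow> has_bye T t i" "has_bye T (r + t) i \<longleftrightarrow> has_bye S t i"
    using has_bye_iff[OF distinct_T T] has_bye_iff[OF distinct_S d] by (auto simp: num_rounds_T)
qed

lemma has_bye_T_S:
  assumes "1 \<le> t" "1 \<le> i" "i \<le> m"
  shows "has_bye T (r + t) i \<longleftrightarrow> has_bye S t i"
proof (cases "i = m")
  case True
  obtain d where "Team m \<in> nodes_at X d"
    using Team_node_of_leaf[of m X] leaves_X m_le_N by auto
  then have "Team m \<in> nodes_at T (s + d)"
    using Team_node_high by simp
  then show ?thesis
    using has_bye_iff[OF distinct_T] has_bye_iff[OF distinct_S deepest] assms(1) True
    by (auto simp: num_rounds_T)
next
  case False
  then show ?thesis
    using assms has_bye_T_low by simp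
qed

text \<open>The demands of properness on \<open>T\<close> split by round: the first \<open>r\<close>
  rounds concern \<open>X\<close>, the later ones concern \<open>S\<close>.\<close>

lemma proper_T: "proper T \<longleftrightarrow> proper X \<and> proper S"
proof (intro iffI conjI)
  assume T: "proper T"
  show "proper X"
    unfolding proper_iff
  proof (intro ballI allI impI; elim conjE)
    fix t i j
    assume t: "t \<in> {1..r}" and ij: "i < j" and alive: "chalk_alive X t i" "chalk_alive X t j"
    then have bds: "m \<le> i" "i \<le> N" "m \<le> j" "j \<le> N"
      using leaves_X by (auto simp: chalk_alive_def)
    have "proper_pair T t i j"
      using T t ij alive bds unfolding proper_iff by (simp add: num_rounds_T chalk_alive_T_X)
    then show "proper_pair X t i j"
      using t bds by (simp add: proper_pair_def has_bye_T_X chalk_game_T_X)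
  qed
  show "proper S"
    unfolding proper_iff
  proof (intro ballI allI impI; elim conjE)
    fix t i j
    assume t: "t \<in> {1..s}" and ij: "i < j" and alive: "chalk_alive S t i" "chalk_alive S t j"
    then have bds: "1 \<le> i" "i \<le> m" "1 \<le> j" "j \<le> m"
      using leaves_S by (auto simp: chalk_alive_def)
    have "r + t \<in> {1..num_rounds T}"
      using t by (simp add: num_rounds_T)
    then have "proper_pair T (r + t) i j"
      using T t ij alive unfolding proper_iff by (simp add: chalk_alive_T_S)
    then show "proper_pair S t i j"
      using t bds by (simp add: proper_pair_def has_bye_T_S chalk_game_T_S)
  qed
next
  assume XS: "proper X \<and> proper S"
  show "proper T"
    unfolding proper_iff
  proof (intro ballI allI impI; elim conjE)
    fix t i j
    assume t: "t \<in> {1..num_rounds T}" and ij: "i < j"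
      and alive: "chalk_alive T t i" "chalk_alive T t j"
    then have bds: "1 \<le> i" "i \<le> N" "1 \<le> j" "j \<le> N"
      using leaves_T by (auto simp: chalk_alive_def)
    consider "t \<le> r" "i < m" | "t \<le> r" "m \<le> i" | "r < t"
      by linarith
    then show "proper_pair T t i j"
    proof cases
      \<comment> \<open>Seed \<open>i\<close> sits out these rounds, so it has the bye that is asked
        for and no opponent to compare.\<close>
      case 1
      have "\<not> chalk_game T t i k" for k
        using 1 chalk_game_T_X chalk_game_leaf[of X t i k] leaves_X by auto
      then show ?thesis
        using 1 has_bye_T_low bds by (simp add: proper_pair_def)
    next
      case 2
      then have "proper_pair X t i j"
        using XS t ij alive bds unfolding proper_iff by (simp add: chalk_alive_T_X)
      then show ?thesis
        using 2 ij bds by (simp add: proper_pair_def has_bye_T_X chalk_game_T_X)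
    next
      case 3
      define t' where "t' = t - r"
      have t': "t = r + t'" "1 \<le> t'" "t' \<le> s"
        using 3 t by (auto simp: t'_def num_rounds_T)
      have alive': "chalk_alive S t' i" "chalk_alive S t' j"
        using alive t' by (simp_all add: chalk_alive_T_S)
      then have "proper_pair S t' i j" "i \<le> m" "j \<le> m"
        using XS t' ij leaves_S unfolding proper_iff by (auto simp: chalk_alive_def)
      then show ?thesis
        using t' bds by (simp add: proper_pair_def has_bye_T_S chalk_game_T_S)
    qed
  qed
qed

end

section \<open>Decomposing a bracket\<close>

context grafting
begin

text \<open>The dropped last entry of \<open>signature X\<close> is 0, since no team of a bracket
  with a round has byes throughout. The 1 subtracted is the replaced leaf \<open>m\<close>.\<close>

lemma signature_T:
  "signature T = butlast (signature X) @ (hd (signature S) - 1) # tl (signature S)"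
proof (rule nth_equalityI)
  show "length (signature T) = length (butlast (signature X) @ (hd (signature S) - 1) # tl (signature S))"
    by (simp add: num_rounds_T)
next
  fix k
  assume "k < length (signature T)"
  then have k: "k \<le> s + r"
    by (simp add: num_rounds_T)
  have hd: "hd (signature S) = signature S ! 0"
    by (rule hd_conv_nth) (metis length_signature list.size(3) nat.distinct(1))
  show "signature T ! k = (butlast (signature X) @ (hd (signature S) - 1) # tl (signature S)) ! k"
    using k by (cases k r rule: linorder_cases)
      (auto simp: nth_signature_T nth_append nth_butlast nth_Cons' nth_tl hd Suc_diff_Suc)
qed

text \<open>In other words, \<open>T\<close> has exactly one game at depth \<open>s\<close>. It is
  put as a count because counts carry over to all brackets with the same signature.\<close>

lemma card_nodes_at_T_s: "card (nodes_at T s) = Suc (card (leaves_at T s))"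
proof -
  have "nodes_at T s = insert X (Team ` leaves_at T s)"
    using X_node nodes_at_T_s by (auto simp: leaves_at_def)
  moreover have "X \<notin> Team ` leaves_at T s"
    using X_not_Team by auto
  moreover have "card (Team ` leaves_at T s) = card (leaves_at T s)"
    by (rule card_image) (simp add: inj_on_def)
  ultimately show ?thesis
    by simp
qed

end

section \<open>Cutting a bracket at a depth, as an inverse of grafting\<close>

fun prune :: "bracket_tree \<Rightarrow> nat \<Rightarrow> bracket_tree" where
  "prune T 0 = Team (chalk_winner T)"
| "prune (Team i) (Suc d) = Team i"
| "prune (Game x y) (Suc d) = Game (prune x d) (prune y d)"

lemma set_leaves_prune: "set (leaves (prune T d)) \<subseteq> set (leaves T)"
  by (induction T d rule: prune.induct) (auto simp: chalk_winner_in_leaves)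

lemma distinct_leaves_prune: "distinct (leaves T) \<Longrightarrow> distinct (leaves (prune T d))"
proof (induction T d rule: prune.induct)
  case (3 x y d)
  then show ?case
    using set_leaves_prune[of x d] set_leaves_prune[of y d] by auto
qed auto

lemma num_rounds_prune: "num_rounds (prune T d) = min d (num_rounds T)"
  by (induction T d rule: prune.induct) auto

lemma nodes_at_prune: "nodes_at (prune T d) d = (\<lambda>Y. Team (chalk_winner Y)) ` nodes_at T d"
  by (induction T d rule: prune.induct) auto

text \<open>The cut replaces \<open>X\<close> by a leaf labelled with its chalk winner, and grafting
  puts it back. A leaf \<open>m\<close> already present at depth at most \<open>d\<close> would be
  hit as well.\<close>

lemma graft_prune:
  assumes "chalk_winner X = m"
  shows "nodes_at T d \<subseteq> insert X (range Team) \<Longrightarrow> (\<And>e. e \<le> d \<Longrightarrow> Team m \<notin> nodes_at T e) \<Longrightarrow>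
    graft m X (prune T d) = T"
proof (induction T d rule: prune.induct)
  case (1 T)
  then show ?case
    using assms by (cases T) auto
next
  case (2 i d)
  then show ?case
    using "2.prems"(2)[of 0] by auto
next
  case (3 x y d)
  have "Team m \<notin> nodes_at x e" "Team m \<notin> nodes_at y e" if "e \<le> d" for e
    using "3.prems"(2)[of "Suc e"] that by auto
  then show ?case
    using 3 by simp
qed

lemma Team_node_graft:
  "i \<noteq> m \<Longrightarrow> Team i \<in> nodes_at S d \<Longrightarrow> Team i \<in> nodes_at (graft m X S) d"
  by (induction S d rule: nodes_at.induct) auto

text \<open>The teams under \<open>X\<close> enter in the first \<open>r\<close> rounds, which all
  others sit out. Properness then makes every team of \<open>X\<close> a lower seed than every other
  team, so the labels of \<open>X\<close> form a final segment \<open>{m..N}\<close>;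
  \<open>S\<close> is the cut at depth \<open>s\<close>.\<close>

lemma proper_bracket_decompose:
  assumes T: "is_bracket N T" and proper: "proper T" and rounds_T: "num_rounds T = s + r"
    and X: "X \<in> nodes_at T s" "0 < num_rounds X" "nodes_at T s \<subseteq> insert X (range Team)"
  shows "\<exists>m S. grafting m N X S \<and> T = graft m X S \<and> num_rounds S = s"
proof -
  define m where "m = chalk_winner X"
  define S where "S = prune T s"
  let ?L = "set (leaves X)"
  have dist: "distinct (leaves T)" and leaves_T: "set (leaves T) = {1..N}"
    using T by (auto simp: is_bracket_def)
  have depth: "\<exists>d. Team i \<in> nodes_at T (s + Suc d)" if i: "i \<in> ?L" for i
  proof -
    obtain d where d: "Team i \<in> nodes_at X d"
      using i Team_node_of_leaf by blast
    then obtain d' where "d = Suc d'"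
      using X(2) by (cases d) auto
    then show ?thesis
      using d X(1) unfolding nodes_at_add by blast
  qed
  have deep: "i \<notin> ?L" if "Team i \<in> nodes_at T e" "e \<le> s" for i e
    using depth[of i] Team_depth_unique[OF dist that(1)] that(2) by fastforce
  have shallow: "e \<le> s" if i: "Team i \<in> nodes_at T e" "i \<notin> ?L" for i e
  proof (rule ccontr)
    assume "\<not> e \<le> s"
    then obtain d where e: "e = s + Suc d"
      by (metis add_Suc_right less_imp_Suc_add not_le)
    then obtain Y where Y: "Y \<in> nodes_at T s" "Team i \<in> nodes_at Y (Suc d)"
      using i(1) unfolding e nodes_at_add by blast
    then have "Y = X"
      using X(3) by auto
    then show False
      using Y(2) leaf_of_Team_node that(2) by blast
  qed
  have lower: "u < x" if u: "u \<in> {1..N}" "u \<notin> ?L" and x: "x \<in> ?L" for u x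
  proof (rule ccontr)
    assume "\<not> u < x"
    then have "x < u"
      using u x by (metis linorder_neqE_nat)
    obtain e where e: "Team u \<in> nodes_at T e"
      using u(1) Team_node_of_leaf[of u T] leaves_T by auto
    then have "e \<le> s"
      using shallow u(2) by blast
    obtain d where d: "Team x \<in> nodes_at T (s + Suc d)"
      using depth x by blast
    then have "Suc d \<le> r"
      using depth_le_num_rounds[OF d] rounds_T by simp
    \<comment> \<open>The round of the first game of \<open>x\<close>; \<open>u\<close> still has a
      bye in it.\<close>
    define t where "t = r - d"
    have t: "t \<in> {1..num_rounds T}"
      using \<open>Suc d \<le> r\<close> by (auto simp: t_def rounds_T)
    have "chalk_alive T t x" "chalk_alive T t u"
      using chalk_alive_first_game[OF dist d, of t] chalk_alive_first_game[OF dist e, of t]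
        \<open>e \<le> s\<close> \<open>Suc d \<le> r\<close> by (auto simp: t_def rounds_T)
    then have "has_bye T t u \<longrightarrow> has_bye T t x"
      using proper t \<open>x < u\<close> unfolding proper_iff proper_pair_def by blast
    then show False
      using has_bye_iff[OF dist d] has_bye_iff[OF dist e] \<open>e \<le> s\<close> \<open>Suc d \<le> r\<close>
      by (simp add: t_def rounds_T)
  qed
  have m: "m \<in> ?L"
    by (simp add: m_def chalk_winner_in_leaves)
  then have m_bounds: "1 \<le> m" "m \<le> N"
    using leaves_node_subset[OF X(1)] leaves_T by auto
  have L: "?L = {m..N}"
  proof
    show "?L \<subseteq> {m..N}"
      using leaves_node_subset[OF X(1)] leaves_T by (auto simp: m_def chalk_winner_eq_Min)
    show "{m..N} \<subseteq> ?L"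
    proof
      fix i
      assume i: "i \<in> {m..N}"
      then have "\<not> i < m" "i \<in> {1..N}"
        using m_bounds by auto
      then show "i \<in> ?L"
        using lower m by blast
    qed
  qed
  have T_eq: "T = graft m X S"
    unfolding S_def using graft_prune[of X m T s] X(3) deep m by (metis m_def)
  have rounds_S: "num_rounds S = s"
    by (simp add: S_def num_rounds_prune rounds_T)
  have m_node: "Team m \<in> nodes_at S s"
    using X(1) by (auto simp: S_def nodes_at_prune m_def)
  \<comment> \<open>A leaf of the cut other than \<open>m\<close> is a leaf of \<open>T\<close> at
    depth at most \<open>s\<close>, whereas the teams of \<open>X\<close> start deeper.\<close>
  have "i \<notin> ?L" if i: "i \<in> set (leaves S)" "i \<noteq> m" for i
  proof -
    obtain e where e: "Team i \<in> nodes_at S e"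
      using i(1) Team_node_of_leaf by blast
    have "e \<le> s"
      using depth_le_num_rounds[OF e] rounds_S by simp
    then show ?thesis
      using deep Team_node_graft[OF i(2) e, of X] T_eq by simp
  qed
  then have "(set (leaves S) - {m}) \<inter> {m..N} = {}"
    using L by blast
  moreover have m_leaf: "m \<in> set (leaves S)"
    using m_node by (rule leaf_of_Team_node)
  moreover have "{1..N} = (set (leaves S) - {m}) \<union> {m..N}"
    using set_leaves_graft[of m X S] T_eq leaves_T L m_leaf by simp
  ultimately have "set (leaves S) = insert m ({1..N} - {m..N})"
    by blast
  also have "\<dots> = {1..m}"
    using m_bounds by auto
  finally have "set (leaves S) = {1..m}" .
  then have "grafting m N X S"
    unfolding grafting_def is_bracket_def
    using distinct_leaves_prune[OF dist, of s] m_node rounds_S L X(2) distinct_leaves_node[OF X(1) dist]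
    by (simp add: S_def)
  then show ?thesis
    using T_eq rounds_S by blast
qed

text \<open>\<open>last A\<close> is left out: for a bracket with at least one round it is 0
  (\<open>last_signature\<close>), and then this is the signature in the theorem.\<close>

definition join_signatures :: "nat list \<Rightarrow> nat list \<Rightarrow> nat list" where
  "join_signatures A B = butlast A @ (hd B - 1) # tl B"

section \<open>What a joined signature determines\<close>

lemma last_signature:
  assumes "0 < num_rounds T"
  shows "last (signature T) = 0"
proof -
  have "last (signature T) = signature T ! num_rounds T"
    by (metis diff_Suc_1 last_conv_nth length_signature list.size(3) nat.distinct(1))
  also have "\<dots> = card (leaves_at T 0)"
    by (simp add: nth_signature)
  also have "leaves_at T 0 = {}"
    using assms by (auto simp: leaves_at_def)
  finally show ?thesis by simp
qed

lemma hd_signature_pos: "0 < hd (signature T)"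
proof -
  have "hd (signature T) = signature T ! 0"
    by (rule hd_conv_nth) (metis length_signature list.size(3) nat.distinct(1))
  also have "\<dots> = card (leaves_at T (num_rounds T))"
    by (simp add: nth_signature)
  finally show ?thesis
    using deepest_leaf[of T] by (auto simp: card_gt_0_iff) (auto simp: leaves_at_def)
qed

text \<open>The round counts fix where the joined list splits. Nothing is lost in joining: the
  dropped entry is 0 and the decremented one was positive.\<close>

lemma join_signatures_inject:
  assumes "0 < num_rounds X" "0 < num_rounds X'"
    and "num_rounds X = num_rounds X'" "num_rounds S = num_rounds S'"
    and "join_signatures (signature X) (signature S) = join_signatures (signature X') (signature S')"
  shows "signature X = signature X'" "signature S = signature S'"
proof -
  have "butlast (signature X) = butlast (signature X')" "hd (signature S) - 1 = hd (signature S') - 1"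
    "tl (signature S) = tl (signature S')"
    using assms by (auto simp: join_signatures_def)
  moreover have "signature U \<noteq> []" for U
    by (metis length_signature list.size(3) nat.distinct(1))
  ultimately show "signature X = signature X'" "signature S = signature S'"
    using hd_signature_pos[of S] hd_signature_pos[of S'] last_signature assms(1,2)
    by (metis append_butlast_last_id, metis One_nat_def Suc_pred list.collapse)
qed

lemma card_leaves_at_cong:
  assumes "signature T = signature T'"
  shows "card (leaves_at T d) = card (leaves_at T' d)"
proof -
  have rounds: "num_rounds T = num_rounds T'"
    using arg_cong[OF assms, of length] by simp
  show ?thesis
  proof (cases "d \<le> num_rounds T")
    case True
    then show ?thesis
      using nth_signature[of "num_rounds T - d" T] nth_signature[of "num_rounds T - d" T'] assms rounds
      by simp
  next
    case False
    then have "leaves_at U d = {}" if "num_rounds U = num_rounds T" for U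
      using depth_le_num_rounds[of _ U d] that by (fastforce simp: leaves_at_def)
    then show ?thesis
      using rounds by simp
  qed
qed

text \<open>Both trees have one node at depth 0, and the recurrence \<open>card_nodes_at_Suc\<close>
  passes equality down the levels.\<close>

lemma card_nodes_at_cong:
  assumes "signature T = signature T'" "distinct (leaves T)" "distinct (leaves T')"
  shows "card (nodes_at T d) = card (nodes_at T' d)"
proof (induction d)
  case (Suc d)
  then show ?case
    using card_nodes_at_Suc[OF assms(2), of d] card_nodes_at_Suc[OF assms(3), of d]
      card_leaves_at_cong[OF assms(1), of d] by simp
qed simp

lemma strict_mono_shift: "strict_mono ((+) (c::nat))"
  by (simp add: strict_mono_def)

text \<open>Shifting by \<open>m - 1\<close> sends the top seed of \<open>X\<close> to
  \<open>m\<close>, the lowest seed of \<open>S\<close>, whose leaf is deepest by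
  \<open>proper_lowest_seed_plays_first\<close>.\<close>

lemma proper_bracket_join:
  assumes A: "proper_bracket_with A X" and B: "proper_bracket_with B S" and "0 < num_rounds X"
  defines "m \<equiv> sum_list B" and "X' \<equiv> relabel ((+) (sum_list B - 1)) X"
  shows "grafting m (m - 1 + sum_list A) X' S"
    and "proper_bracket_with (join_signatures A B) (graft m X' S)"
    and "sum_list (join_signatures A B) = m - 1 + sum_list A"
proof -
  have X: "distinct (leaves X)" "set (leaves X) = {1..sum_list A}" "proper X" "signature X = A"
    and S: "is_bracket m S" "proper S" "signature S = B"
    using A B by (auto simp: proper_bracket_with_def is_bracket_def m_def)
  have "1 \<le> m"
    using S(1) chalk_winner_in_leaves[of S] by (auto simp: is_bracket_def)
  then have "(+) (m - 1) ` {1..sum_list A} = {m..m - 1 + sum_list A}"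
    using image_add_atLeastAtMost[of "m - 1" 1 "sum_list A"] by (simp add: add.commute)
  then have "set (leaves X') = {m..m - 1 + sum_list A}"
    by (simp only: X'_def X(2) leaves_relabel set_map m_def)
  then show g: "grafting m (m - 1 + sum_list A) X' S"
    unfolding grafting_def
    using S proper_lowest_seed_plays_first[OF S(1,2)] X(1) assms(3)
    by (simp add: X'_def distinct_map)
  interpret G: grafting m "m - 1 + sum_list A" X' S
    by (rule g)
  have sig: "signature (graft m X' S) = join_signatures A B"
    using X(4) S(3) G.signature_T
    by (simp add: join_signatures_def X'_def signature_relabel)
  \<comment> \<open>Both sides count the teams of the grafted bracket, which bypasses the
    subtraction in the list.\<close>
  show sum: "sum_list (join_signatures A B) = m - 1 + sum_list A"
    unfolding sig[symmetric] by (simp add: sum_list_signature G.distinct_T G.leaves_T)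
  show "proper_bracket_with (join_signatures A B) (graft m X' S)"
    unfolding proper_bracket_with_def sum
    using G.is_bracket_T sig G.proper_T X(3) S(2)
    by (simp add: X'_def proper_relabel strict_mono_shift)
qed

text \<open>\<open>T\<close> is compared with the bracket grafted from \<open>Y\<close> and
  \<open>Z\<close>. Equal signatures give equal counts of nodes and leaves at each depth, so
  \<open>T\<close> also has a single game at depth \<open>num_rounds Z\<close>, and
  \<open>proper_bracket_decompose\<close> applies there.\<close>

lemma proper_bracket_join_cases:
  assumes A: "proper_bracket_with A Y" and B: "proper_bracket_with B Z" and r: "0 < num_rounds Y"
    and T: "proper_bracket_with (join_signatures A B) T"
  defines "m \<equiv> sum_list B"
  obtains X S where "proper_bracket_with A X" "proper_bracket_with B S"
    "grafting m (m - 1 + sum_list A) (relabel ((+) (m - 1)) X) S"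
    "T = graft m (relabel ((+) (m - 1)) X) S"
proof -
  let ?Y = "relabel ((+) (m - 1)) Y"
  note join = proper_bracket_join[OF A B r, folded m_def]
  interpret YZ: grafting m "m - 1 + sum_list A" ?Y Z
    by (rule join(1))
  have sig: "signature T = signature YZ.T" and dist: "distinct (leaves T)"
    and bracket: "is_bracket (m - 1 + sum_list A) T" and proper: "proper T"
    using T join by (auto simp: proper_bracket_with_def is_bracket_def)
  have rounds: "num_rounds T = num_rounds Z + num_rounds Y"
    using arg_cong[OF sig, of length] YZ.num_rounds_T by simp
  let ?s = "num_rounds Z"
  have "card (nodes_at T ?s - Team ` leaves_at T ?s) = 1"
  proof -
    have "card (nodes_at T ?s) = Suc (card (leaves_at T ?s))"
      using YZ.card_nodes_at_T_s card_nodes_at_cong[OF sig dist YZ.distinct_T] card_leaves_at_cong[OF sig]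
      by simp
    moreover have "card (Team ` leaves_at T ?s) = card (leaves_at T ?s)"
      by (rule card_image) (simp add: inj_on_def)
    moreover have "Team ` leaves_at T ?s \<subseteq> nodes_at T ?s"
      by (auto simp: leaves_at_def)
    ultimately show ?thesis
      by (simp add: card_Diff_subset)
  qed
  then obtain X where X: "nodes_at T ?s - Team ` leaves_at T ?s = {X}"
    by (meson card_1_singletonE)
  then have X_node: "X \<in> nodes_at T ?s" and only: "nodes_at T ?s \<subseteq> insert X (range Team)"
    by auto
  moreover have "0 < num_rounds X"
    using X by (cases X) (auto simp: leaves_at_def)
  ultimately obtain k S where kS: "grafting k (m - 1 + sum_list A) X S"
    and T_eq: "T = graft k X S" and rounds_S: "num_rounds S = ?s"
    using proper_bracket_decompose[OF bracket proper rounds] by blast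
  interpret XS: grafting k "m - 1 + sum_list A" X S
    by (rule kS)
  have rounds_X: "num_rounds X = num_rounds Y"
    using rounds XS.num_rounds_T T_eq rounds_S by simp
  have "join_signatures (signature X) (signature S) = join_signatures (signature Y) (signature Z)"
    using sig XS.signature_T YZ.signature_T T_eq
    by (simp add: join_signatures_def signature_relabel)
  note sigs = join_signatures_inject[OF XS.rounds_X r rounds_X rounds_S this]
  have A': "A = signature X" and B': "B = signature S"
    using A B sigs by (auto simp: proper_bracket_with_def)
  have k: "k = m"
    unfolding m_def B' by (simp add: sum_list_signature[OF XS.distinct_S] XS.leaves_S)
  \<comment> \<open>Labels of \<open>X\<close> start at \<open>m\<close>, so the subtraction is
    never truncated and inverts the shift.\<close>
  define X' where "X' = relabel (\<lambda>i. i - (m - 1)) X"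
  have X_eq: "X = relabel ((+) (m - 1)) X'"
    unfolding X'_def using XS.leaves_X k by (intro relabel_relabel_id[symmetric]) auto
  have "(\<lambda>i. i - (m - 1)) ` {m..m - 1 + sum_list A} = {1..sum_list A}"
  proof
    show "{1..sum_list A} \<subseteq> (\<lambda>i. i - (m - 1)) ` {m..m - 1 + sum_list A}"
    proof
      fix i
      assume "i \<in> {1..sum_list A}"
      then show "i \<in> (\<lambda>i. i - (m - 1)) ` {m..m - 1 + sum_list A}"
        using XS.m_pos k by (intro image_eqI[of _ _ "m - 1 + i"]) auto
    qed
  qed (use XS.m_pos k in auto)
  moreover have "distinct (leaves X')"
    using XS.distinct_X unfolding X_eq by (simp add: distinct_map)
  ultimately have "is_bracket (sum_list A) X'"
    using XS.leaves_X k by (simp add: is_bracket_def X'_def)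
  moreover have "proper X'" "signature X' = A"
    using XS.proper_T proper T_eq A' unfolding X_eq
    by (auto simp: proper_relabel strict_mono_shift signature_relabel)
  ultimately have "proper_bracket_with A X'"
    by (simp add: proper_bracket_with_def)
  moreover have "proper_bracket_with B S"
    using XS.S XS.proper_T proper T_eq B' k by (simp add: proper_bracket_with_def m_def)
  ultimately show ?thesis
    using that kS T_eq unfolding X_eq k by blast
qed

section \<open>The champion of a grafted bracket\<close>

lemma set_pmf_champion: "set_pmf (champion T p) \<subseteq> set (leaves T)"
  by (induction T) (auto simp: set_bind_pmf split: if_splits)

lemma finite_set_pmf_champion: "finite (set_pmf (champion T p))"
  using finite_subset[OF set_pmf_champion] by blast

lemma champion_cong:
  "(\<And>i j. i \<in> set (leaves T) \<Longrightarrow> j \<in> set (leaves T) \<Longrightarrow> p i j = q i j) \<Longrightarrow> champion T p = champion T q"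
proof (induction T)
  case (Game x y)
  have xy: "champion x p = champion x q" "champion y p = champion y q"
    using Game by auto
  have "i \<in> set (leaves x)" if "i \<in> set_pmf (champion x q)" for i
    using that set_pmf_champion by blast
  moreover have "j \<in> set (leaves y)" if "j \<in> set_pmf (champion y q)" for j
    using that set_pmf_champion by blast
  ultimately show ?case
    unfolding champion.simps xy using Game.prems by (intro bind_pmf_cong refl) simp
qed simp

lemma champion_relabel: "champion (relabel f T) p = map_pmf f (champion T (\<lambda>i j. p (f i) (f j)))"
  by (induction T) (simp_all add: map_pmf_def bind_assoc_pmf bind_return_pmf if_distrib[of f])

text \<open>Condition on the winner \<open>k\<close> of \<open>X\<close>: the remaining games are
  those of \<open>S\<close> with \<open>k\<close> in the role of \<open>m\<close>. In the half
  without \<open>m\<close> neither operation changes anything.\<close>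

lemma champion_graft:
  "distinct (leaves S) \<Longrightarrow> m \<in> set (leaves S) \<Longrightarrow>
    champion (graft m X S) p = bind_pmf (champion X p) (\<lambda>k. champion (relabel (id(m := k)) S) p)"
proof (induction S)
  case (Team i)
  then show ?case by (simp add: bind_return_pmf')
next
  case (Game x y)
  have idle: "relabel (id(m := k)) z = z" if "m \<notin> set (leaves z)" for z k
    using that by (intro relabel_id) auto
  show ?case
  proof (cases "m \<in> set (leaves x)")
    case True
    then have y: "m \<notin> set (leaves y)" and x: "distinct (leaves x)"
      using Game.prems by auto
    show ?thesis
      by (simp only: graft.simps relabel.simps champion.simps Game.IH(1)[OF x True]
          graft_idle[OF y] idle[OF y] bind_assoc_pmf)
  next
    case False
    then have m: "m \<in> set (leaves y)" and y: "distinct (leaves y)"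
      using Game.prems by auto
    \<comment> \<open>The draw for \<open>X\<close> now comes after that for \<open>x\<close>;
      independence allows the two to be exchanged.\<close>
    show ?thesis
      by (simp only: graft.simps relabel.simps champion.simps Game.IH(2)[OF y m]
          graft_idle[OF False] idle[OF False] bind_assoc_pmf
          bind_commute_pmf[of "champion x p" "champion X p"])
  qed
qed

section \<open>Title chances and their monotonicity in the strength of one team\<close>

lemma pmf_game:
  assumes "0 \<le> p i j" "p i j \<le> (1::real)"
  shows "pmf (bind_pmf (bernoulli_pmf (p i j)) (\<lambda>w. return_pmf (if w then i else j))) m
    = (if i = m then p i j else 0) + (if j = m then 1 - p i j else 0)"
  using assms by (simp add: pmf_bind integral_bernoulli_pmf pmf_return)

lemma expectation_single:
  "measure_pmf.expectation M (\<lambda>i. if i = m then c else (0::real)) = pmf M m * c"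
proof -
  have "measure_pmf.expectation M (\<lambda>i. if i = m then c else 0)
    = (\<Sum>i\<in>{m}. (if i = m then c else 0) * pmf M i)"
    by (rule integral_measure_pmf_real) (auto split: if_splits)
  then show ?thesis by simp
qed

lemma expectation_cong:
  assumes "\<And>i. i \<in> set_pmf M \<Longrightarrow> f i = g i"
  shows "measure_pmf.expectation M f = measure_pmf.expectation M (g :: _ \<Rightarrow> real)"
  by (rule integral_cong_AE) (auto simp: AE_measure_pmf_iff assms)

text \<open>The bounds matter because \<open>bernoulli_pmf\<close> truncates its argument to the
  unit interval.\<close>

lemma pmf_champion_Game:
  assumes "\<And>i j. i \<in> set (leaves (Game x y)) \<Longrightarrow> j \<in> set (leaves (Game x y)) \<Longrightarrow> 0 \<le> p i j \<and> p i j \<le> 1"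
  shows "pmf (champion (Game x y) p) m = measure_pmf.expectation (champion x p) (\<lambda>i.
    measure_pmf.expectation (champion y p) (\<lambda>j.
      (if i = m then p i j else 0) + (if j = m then 1 - p i j else 0)))"
  unfolding champion.simps pmf_bind[of "champion x p"] pmf_bind[of "champion y p"]
  using assms set_pmf_champion[of x p] set_pmf_champion[of y p]
  by (intro expectation_cong pmf_game) auto

text \<open>Only the half \<open>x\<close> can send \<open>m\<close> into the game, and the halves
  are independent, so the chance factors.\<close>

lemma pmf_champion_Game_left:
  assumes "\<And>i j. i \<in> set (leaves (Game x y)) \<Longrightarrow> j \<in> set (leaves (Game x y)) \<Longrightarrow> 0 \<le> p i j \<and> p i j \<le> 1"
    and m: "m \<notin> set (leaves y)"
  shows "pmf (champion (Game x y) p) m =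
    pmf (champion x p) m * measure_pmf.expectation (champion y p) (\<lambda>j. p m j)"
proof -
  have "measure_pmf.expectation (champion y p) (\<lambda>j. (if i = m then p i j else 0) + (if j = m then 1 - p i j else 0))
    = measure_pmf.expectation (champion y p) (\<lambda>j. if i = m then p m j else 0)" for i
    using m set_pmf_champion by (intro expectation_cong) auto
  moreover have "\<dots> i = (if i = m then measure_pmf.expectation (champion y p) (\<lambda>j. p m j) else 0)" for i
    by simp
  ultimately show ?thesis
    by (subst pmf_champion_Game[where p = p], intro assms(1)) (simp_all add: expectation_single)
qed

lemma pmf_champion_Game_right:
  assumes "\<And>i j. i \<in> set (leaves (Game x y)) \<Longrightarrow> j \<in> set (leaves (Game x y)) \<Longrightarrow> 0 \<le> p i j \<and> p i j \<le> 1"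
    and m: "m \<notin> set (leaves x)"
  shows "pmf (champion (Game x y) p) m =
    pmf (champion y p) m * measure_pmf.expectation (champion x p) (\<lambda>i. 1 - p i m)"
proof -
  have "pmf (champion (Game x y) p) m = measure_pmf.expectation (champion x p) (\<lambda>i.
    measure_pmf.expectation (champion y p) (\<lambda>j. if j = m then 1 - p i m else 0))"
    using m set_pmf_champion[of x p]
    by (subst pmf_champion_Game[where p = p], intro assms(1)) (auto intro!: expectation_cong)
  then show ?thesis
    by (simp add: expectation_single)
qed

text \<open>At each game the chance of \<open>m\<close> is a product: its chance in its own half,
  compared by induction, times its mean chance against the other half, whose champion has the same
  distribution under \<open>p\<close> and \<open>q\<close>. Both \<open>p m i\<close> and
  \<open>p i m\<close> are compared as \<open>m\<close> may come from either child.\<close>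

lemma pmf_champion_mono:
  assumes "distinct (leaves T)" "m \<in> set (leaves T)"
    and "\<And>i j. i \<in> set (leaves T) \<Longrightarrow> j \<in> set (leaves T) \<Longrightarrow> 0 \<le> p i j \<and> p i j \<le> 1 \<and> 0 \<le> q i j \<and> q i j \<le> 1"
    and "\<And>i j. i \<in> set (leaves T) \<Longrightarrow> j \<in> set (leaves T) \<Longrightarrow> i \<noteq> m \<Longrightarrow> j \<noteq> m \<Longrightarrow> p i j = q i j"
    and "\<And>i. i \<in> set (leaves T) \<Longrightarrow> i \<noteq> m \<Longrightarrow> q m i \<le> p m i \<and> p i m \<le> q i m"
  shows "pmf (champion T q) m \<le> pmf (champion T p) m"
  using assms
proof (induction T)
  case (Game x y)
  have mono: "measure_pmf.expectation (champion z p) f \<le> measure_pmf.expectation (champion z p) g"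
    if "\<And>i. i \<in> set (leaves z) \<Longrightarrow> f i \<le> g i" for z and f g :: "nat \<Rightarrow> real"
    using that set_pmf_champion
    by (intro integral_mono_AE integrable_measure_pmf_finite finite_set_pmf_champion)
      (auto simp: AE_measure_pmf_iff)
  have nonneg: "0 \<le> measure_pmf.expectation (champion z q) f"
    if "\<And>i. i \<in> set (leaves z) \<Longrightarrow> 0 \<le> f i" for z and f :: "nat \<Rightarrow> real"
    using that set_pmf_champion by (intro integral_nonneg_AE) (auto simp: AE_measure_pmf_iff)
  show ?case
  proof (cases "m \<in> set (leaves x)")
    case True
    then have m: "m \<notin> set (leaves y)"
      using Game.prems(1) by auto
    have y: "champion y q = champion y p"
      using Game.prems(4) m by (intro champion_cong sym[OF Game.prems(4)]) auto
    have Game_p: "pmf (champion (Game x y) p) m =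
        pmf (champion x p) m * measure_pmf.expectation (champion y p) (p m)"
      and Game_q: "pmf (champion (Game x y) q) m =
        pmf (champion x q) m * measure_pmf.expectation (champion y q) (q m)"
      using Game.prems(3) by (intro pmf_champion_Game_left m; blast)+
    have "pmf (champion x q) m \<le> pmf (champion x p) m"
      using Game.prems True by (intro Game.IH(1)) auto
    moreover have "measure_pmf.expectation (champion y p) (q m) \<le> measure_pmf.expectation (champion y p) (p m)"
      using Game.prems(5) m by (intro mono) auto
    moreover have "0 \<le> measure_pmf.expectation (champion y q) (q m)"
      using Game.prems(3) True by (intro nonneg) auto
    ultimately show ?thesis
      unfolding Game_p Game_q y by (intro mult_mono) auto
  next
    case False
    have m: "m \<in> set (leaves y)"
      using Game.prems(2) False by auto
    have x: "champion x q = champion x p"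
      using Game.prems(4) False by (intro champion_cong sym[OF Game.prems(4)]) auto
    have Game_p: "pmf (champion (Game x y) p) m =
        pmf (champion y p) m * measure_pmf.expectation (champion x p) (\<lambda>i. 1 - p i m)"
      and Game_q: "pmf (champion (Game x y) q) m =
        pmf (champion y q) m * measure_pmf.expectation (champion x q) (\<lambda>i. 1 - q i m)"
      using Game.prems(3) by (intro pmf_champion_Game_right False; blast)+
    have "pmf (champion y q) m \<le> pmf (champion y p) m"
      using Game.prems m by (intro Game.IH(2)) auto
    moreover have "measure_pmf.expectation (champion x p) (\<lambda>i. 1 - q i m)
      \<le> measure_pmf.expectation (champion x p) (\<lambda>i. 1 - p i m)"
      using Game.prems(5) False by (intro mono) auto
    moreover have "0 \<le> measure_pmf.expectation (champion x q) (\<lambda>i. 1 - q i m)"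
      using Game.prems(3) m by (intro nonneg) auto
    ultimately show ?thesis
      unfolding Game_p Game_q x by (intro mult_mono) auto
  qed
qed simp

lemma pmf_map_inj_on:
  assumes "inj_on f A" "set_pmf M \<subseteq> A" "x \<in> A"
  shows "pmf (map_pmf f M) (f x) = pmf M x"
proof -
  have "pmf (map_pmf f M) (f x) = measure_pmf.prob M (f -` {f x} \<inter> set_pmf M)"
    by (simp add: pmf_map measure_Int_set_pmf)
  also have "f -` {f x} \<inter> set_pmf M = {x} \<inter> set_pmf M"
    using assms by (auto simp: inj_on_def)
  also have "measure_pmf.prob M \<dots> = pmf M x"
    by (simp add: measure_Int_set_pmf measure_pmf_single)
  finally show ?thesis .
qed

section \<open>Ordered formats on a sublist of the teams\<close>

lemma SST_comp:
  assumes "SST N p" "f ` {1..n} \<subseteq> {1..N}" "strict_mono_on {1..n} f"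
  shows "SST n (\<lambda>i j. p (f i) (f j))"
  using assms unfolding SST_def is_matchup_table_def
  by (simp add: image_subset_iff strict_mono_onD)

lemma pmf_champion_relabel:
  assumes "is_bracket n T" "inj_on f {1..n}" "i \<in> {1..n}"
  shows "pmf (champion (relabel f T) p) (f i) = pmf (champion T (\<lambda>i j. p (f i) (f j))) i"
  unfolding champion_relabel
  using assms set_pmf_champion[of T] by (intro pmf_map_inj_on) (auto simp: is_bracket_def)

text \<open>A sublist in seed order is again SST. This is used for \<open>X\<close> with a shift and
  for \<open>S\<close> with the winner of \<open>X\<close> in the last place.\<close>

lemma ordered_format_relabel:
  assumes "ordered_format n (champion T)" "is_bracket n T"
    and "SST N p" "f ` {1..n} \<subseteq> {1..N}" "strict_mono_on {1..n} f"
    and "i \<in> {1..n}" "j \<in> {1..n}" "i < j"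
  shows "pmf (champion (relabel f T) p) (f j) \<le> pmf (champion (relabel f T) p) (f i)"
  using assms SST_comp[OF assms(3-5)] strict_mono_on_imp_inj_on[OF assms(5)]
  by (auto simp: pmf_champion_relabel ordered_format_def)

context grafting
begin

lemma ordered_graft:
  assumes X': "X = relabel ((+) (m - 1)) X'" "is_bracket n X'" "N = m - 1 + n"
    and ordered_X': "ordered_format n (champion X')"
    and ordered_S: "ordered_format m (champion S)"
  shows "ordered_format N (champion T)"
  unfolding ordered_format_def
proof (intro allI impI ballI)
  fix p i j
  assume p: "SST N p" and ij: "i \<in> {1..N}" "j \<in> {1..N}" "i < j"
  \<comment> \<open>\<open>g k\<close> hands the slot of \<open>m\<close> in \<open>S\<close> to
    \<open>k\<close>; for \<open>k\<close> at least \<open>m\<close> it is increasing on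
    \<open>{1..m}\<close>. \<open>Q k\<close> is the title distribution given that \<open>k\<close>
    wins \<open>X\<close>, which has probability \<open>W k\<close>.\<close>
  define g where "g k = id(m := k)" for k
  define Q where "Q k = champion (relabel (g k) S) p" for k
  define W where "W = pmf (champion X p)"
  have entries: "0 \<le> p i j \<and> p i j \<le> 1 \<and> p i j + p j i = 1" if "i \<in> {1..N}" "j \<in> {1..N}" for i j
    using p that unfolding SST_def is_matchup_table_def by blast
  have g_mono: "strict_mono_on {1..m} (g k)" and g_range: "g k ` {1..m} \<subseteq> {1..N}" if "k \<in> {m..N}" for k
    using that m_pos m_le_N by (auto simp: g_def strict_mono_on_def)
  note g_inj = strict_mono_on_imp_inj_on[OF g_mono]
  have T: "pmf (champion T p) l = (\<Sum>k\<in>{m..N}. pmf (Q k) l * W k)" for l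
  proof -
    have "m \<in> set (leaves S)"
      using deepest by (rule leaf_of_Team_node)
    then have "pmf (champion T p) l = measure_pmf.expectation (champion X p) (\<lambda>k. pmf (Q k) l)"
      by (simp add: champion_graft distinct_S pmf_bind Q_def g_def)
    also have "\<dots> = (\<Sum>k\<in>{m..N}. pmf (Q k) l * W k)"
      unfolding W_def using set_pmf_champion[of X p] leaves_X
      by (intro integral_measure_pmf_real) auto
    finally show ?thesis .
  qed
  have W_nonneg: "0 \<le> W k" for k
    by (simp add: W_def)
  \<comment> \<open>A team of \<open>X\<close> can only be champion after winning \<open>X\<close>
    itself, since otherwise it does not occur in the relabelled \<open>S\<close>; one summand
    remains.\<close>
  have T_high: "pmf (champion T p) l = pmf (Q l) l * W l" if l: "l \<in> {m..N}" for l
  proof -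
    have "pmf (Q k) l = 0" if "k \<in> {m..N} - {l}" for k
    proof -
      have "l \<notin> set (leaves (relabel (g k) S))"
        using l that by (auto simp: leaves_S g_def)
      then show ?thesis
        using set_pmf_champion[of "relabel (g k) S" p] by (auto simp: Q_def set_pmf_eq)
    qed
    then show ?thesis
      unfolding T using l by (simp add: sum.remove[of _ l])
  qed
  have Q_ordered: "pmf (Q k) (g k v) \<le> pmf (Q k) (g k u)"
    if "k \<in> {m..N}" "u \<in> {1..m}" "v \<in> {1..m}" "u < v" for k u v
    unfolding Q_def using that ordered_format_relabel[OF ordered_S S p g_range g_mono] by blast
  consider "j < m" | "i < m" "m \<le> j" | "m \<le> i"
    using ij by linarith
  then show "pmf (champion T p) j \<le> pmf (champion T p) i"
  proof cases
    case 1
    then have "pmf (Q k) j \<le> pmf (Q k) i" if "k \<in> {m..N}" for k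
      using Q_ordered[OF that, of i j] ij by (simp add: g_def)
    then show ?thesis
      unfolding T by (intro sum_mono mult_right_mono W_nonneg)
  next
    \<comment> \<open>Of the sum for \<open>i\<close> only the term \<open>k = j\<close> is kept:
      when \<open>j\<close> plays as seed \<open>m\<close>, it is no likelier than \<open>i\<close>
      to win since \<open>S\<close> is ordered.\<close>
    case 2
    then have j: "j \<in> {m..N}"
      using ij by simp
    have "pmf (champion T p) j = pmf (Q j) j * W j"
      using j by (rule T_high)
    also have "\<dots> \<le> pmf (Q j) i * W j"
      using Q_ordered[OF j, of i m] 2 ij m_pos by (intro mult_right_mono W_nonneg) (simp add: g_def)
    also have "\<dots> \<le> pmf (champion T p) i"
      unfolding T using j W_nonneg by (intro member_le_sum) auto
    finally show ?thesis .
  next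
    case 3
    then have i: "i \<in> {m..N}" and j: "j \<in> {m..N}"
      using ij by auto
    \<comment> \<open>By \<open>T_high\<close> both chances are products; the factor
      \<open>W\<close> compares because \<open>X'\<close> is ordered.\<close>
    have "W j \<le> W i"
    proof -
      have "pmf (champion X p) ((m - 1) + (j - (m - 1))) \<le> pmf (champion X p) ((m - 1) + (i - (m - 1)))"
        unfolding X'(1)
      proof (rule ordered_format_relabel[OF ordered_X' X'(2) p])
        show "(+) (m - 1) ` {1..n} \<subseteq> {1..N}"
          using X'(3) by auto
        show "strict_mono_on {1..n} ((+) (m - 1))"
          by (simp add: strict_mono_on_def)
        show "i - (m - 1) \<in> {1..n}" "j - (m - 1) \<in> {1..n}" "i - (m - 1) < j - (m - 1)"
          using i j ij m_pos X'(3) by auto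
      qed
      then show ?thesis
        using i j unfolding W_def by (simp only: le_add_diff_inverse atLeastAtMost_iff diff_le_self le_trans[of "m - 1" m])
    qed
    \<comment> \<open>The same slot \<open>m\<close> of \<open>S\<close> is played by
      \<open>i\<close> or by \<open>j\<close>, and by SST \<open>i\<close> does at least as well
      against every other entrant.\<close>
    moreover have "pmf (Q j) j \<le> pmf (Q i) i"
    proof -
      have Q: "pmf (Q k) k = pmf (champion S (\<lambda>u v. p (g k u) (g k v))) m" if "k \<in> {m..N}" for k
        using pmf_champion_relabel[OF S g_inj[OF that], of m p] m_pos by (simp add: Q_def g_def)
      show ?thesis
        unfolding Q[OF i] Q[OF j]
      proof (rule pmf_champion_mono[OF distinct_S])
        show "m \<in> set (leaves S)"
          using deepest by (rule leaf_of_Team_node)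
        fix u
        assume u: "u \<in> set (leaves S)"
        {
          fix v
          assume "v \<in> set (leaves S)"
          then have "{g i u, g i v, g j u, g j v} \<subseteq> {1..N}"
            using u g_range[OF i] g_range[OF j] unfolding leaves_S by blast
          then show "0 \<le> p (g i u) (g i v) \<and> p (g i u) (g i v) \<le> 1 \<and>
            0 \<le> p (g j u) (g j v) \<and> p (g j u) (g j v) \<le> 1"
            using entries by simp
          show "p (g i u) (g i v) = p (g j u) (g j v)" if "u \<noteq> m" "v \<noteq> m"
            using that by (simp add: g_def)
        }
        assume "u \<noteq> m"
        have u': "u \<in> {1..N}"
          using u m_le_N by (simp add: leaves_S)
        have "p u i \<le> p u j"
          using p u' ij unfolding SST_def by blast
        then show "p (g j m) (g j u) \<le> p (g i m) (g i u) \<and> p (g i u) (g i m) \<le> p (g j u) (g j m)"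
          using entries[OF u' ij(1)] entries[OF u' ij(2)] \<open>u \<noteq> m\<close> by (simp add: g_def)
      qed
    qed
    ultimately show ?thesis
      unfolding T_high[OF i] T_high[OF j] by (intro mult_mono W_nonneg) auto
  qed
qed

end

text \<open>The length condition says that \<open>A\<close> has at least one round. Existence comes
  from \<open>proper_bracket_join\<close>; the decomposition reduces every representing tree to
  \<open>ordered_graft\<close>.\<close>

lemma ordered_bracket_join:
  assumes A: "ordered_bracket A" "1 < length A" and B: "ordered_bracket B"
  shows "ordered_bracket (join_signatures A B)"
proof -
  obtain Y Z where Y: "proper_bracket_with A Y" and Z: "proper_bracket_with B Z"
    using A B unfolding ordered_bracket_def by blast
  have rounds_Y: "0 < num_rounds Y"
    using Y A(2) length_signature[of Y] by (auto simp: proper_bracket_with_def)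
  note join = proper_bracket_join[OF Y Z rounds_Y]
  have "ordered_format (sum_list (join_signatures A B)) (champion T)"
    if T: "proper_bracket_with (join_signatures A B) T" for T
  proof -
    obtain X S where XS: "proper_bracket_with A X" "proper_bracket_with B S"
      and g: "grafting (sum_list B) (sum_list B - 1 + sum_list A) (relabel ((+) (sum_list B - 1)) X) S"
      and T_eq: "T = graft (sum_list B) (relabel ((+) (sum_list B - 1)) X) S"
      using proper_bracket_join_cases[OF Y Z rounds_Y T] by blast
    have "ordered_format (sum_list A) (champion X)" "ordered_format (sum_list B) (champion S)"
      "is_bracket (sum_list A) X"
      using A B XS by (auto simp: ordered_bracket_def proper_bracket_with_def)
    then show ?thesis
      unfolding join(3) T_eq by (intro grafting.ordered_graft[OF g]) auto
  qed
  then show ?thesis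
    using join(2) unfolding ordered_bracket_def by blast
qed

theorem lemma2p4p2:
  fixes a b :: "nat \<Rightarrow> nat" and r s :: nat
  assumes "ordered_bracket (map a [0..<Suc r])"
    and "ordered_bracket (map b [0..<Suc s])"
  shows "ordered_bracket (map a [0..<r] @ [a r + b 0 - 1] @ map b [1..<Suc s])"
proof -
  obtain Y where Y: "is_bracket (sum_list (map a [0..<Suc r])) Y" "signature Y = map a [0..<Suc r]"
    using assms(1) by (auto simp: ordered_bracket_def proper_bracket_with_def)
  have rounds_Y: "num_rounds Y = r"
    using arg_cong[OF Y(2), of length] by simp
  have b: "map b [0..<Suc s] = b 0 # map b [1..<Suc s]"
    by (simp add: upt_conv_Cons del: upt_Suc)
  show ?thesis
  proof (cases "r = 0")
    \<comment> \<open>Without rounds the bracket of \<open>A\<close> is a single team, so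
      \<open>a 0 = 1\<close> and the joined list is the signature of \<open>B\<close>.\<close>
    case True
    then obtain i where "Y = Team i"
      using rounds_Y num_rounds_eq_0_iff by blast
    then have "a 0 = 1"
      using Y(2) True by (simp add: signature_def)
    then show ?thesis
      using assms(2) True b by simp
  next
    \<comment> \<open>With a round \<open>a r = 0\<close>, so the middle entry is
      \<open>b 0 - 1\<close> as in \<open>join_signatures\<close>.\<close>
    case False
    then have "a r = 0"
      using last_signature[of Y] Y(2) rounds_Y by simp
    then have "map a [0..<r] @ [a r + b 0 - 1] @ map b [1..<Suc s]
      = join_signatures (map a [0..<Suc r]) (map b [0..<Suc s])"
      unfolding join_signatures_def b by simp
    then show ?thesis
      using ordered_bracket_join[OF assms(1) _ assms(2)] False by simp
  qed
qed

end
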